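(* Let $K,K'$ be edge-path connected simplicial complexes with $\dim(K)$ finite, and let $\varphi,\psi:K\to K'$ be simplicial maps. Then $\mathrm{SD}_{\dim(K)}(\varphi,\psi)=\mathrm{SD}(\varphi,\psi)$.
   Context: Simplicial complexes are abstract simplicial complexes. Simplicial maps $f,g:A\to B$ are contiguous, $f\sim_c g$, if for every simplex $\{v_0,\dots,v_k\}$ of $A$ the set $\{f(v_0),\dots,f(v_k),g(v_0),\dots,g(v_k)\}$ is a simplex of $B$. They are in the same contiguity class, $f\sim g$, if there is a finite sequence of simplicial maps $f=f_0\sim_c f_1\sim_c\dots\sim_c f_n=g$ from $A$ to $B$. The contiguity distance $\mathrm{SD}(\varphi,\psi)$ is the least integer $k\ge 0$ such that $K$ is covered by subcomplexes $K_0,\dots,K_k$ with $\varphi|_{K_j}\sim\psi|_{K_j}$ for all $j$ ($\infty$ if no such cover exists). For an integer $m\ge 0$, the $m$-contiguity distance $\mathrm{SD}_m(\varphi,\psi)$ is the least integer $k\ge 0$ such that $K$ is covered by subcomplexes $K_0,\dots,K_k$ with the property that for each $j$ and every simplicial map $\eta:P\to K_j$ from an $m$-dimensional simplicial complex $P$, $\varphi\circ\eta\sim\psi\circ\eta$ ($\infty$ if no such cover exists). *)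

theory Defs
  imports "HOL-Library.Extended_Nat"
begin

text \<open>
  A complex is given by its set of (nonempty, finite) simplices; its vertices are the elements
  of \<open>\<Union>K\<close>, and \<open>v\<close> is a vertex iff \<open>{v}\<close> is a simplex. Complexes may be
  infinite, and the empty complex is allowed (as a subcomplex).
\<close>

definition abstract_complex :: "'a set set \<Rightarrow> bool" where
  "abstract_complex K \<longleftrightarrow>
     (\<forall>\<sigma>\<in>K. finite \<sigma> \<and> \<sigma> \<noteq> {}) \<and>
     (\<forall>\<sigma>\<in>K. \<forall>\<tau>. \<tau> \<noteq> {} \<and> \<tau> \<subseteq> \<sigma> \<longrightarrow> \<tau> \<in> K)"

definition subcomplex :: "'a set set \<Rightarrow> 'a set set \<Rightarrow> bool" where
  "subcomplex L K \<longleftrightarrow> abstract_complex L \<and> L \<subseteq> K"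

text \<open>
  A relation rather than a function, so that infinite-dimensional complexes and the empty complex
  have no dimension instead of a default value.
\<close>

definition has_dimension :: "'a set set \<Rightarrow> nat \<Rightarrow> bool" where
  "has_dimension K m \<longleftrightarrow> (\<exists>\<sigma>\<in>K. card \<sigma> = Suc m) \<and> (\<forall>\<sigma>\<in>K. card \<sigma> \<le> Suc m)"

definition edge_path_connected :: "'a set set \<Rightarrow> bool" where
  "edge_path_connected K \<longleftrightarrow> (\<forall>u\<in>\<Union>K. \<forall>v\<in>\<Union>K. (\<lambda>x y. {x, y} \<in> K)\<^sup>*\<^sup>* u v)"

text \<open>
  Maps are total functions on the vertex type, of which only the values on the vertices of the
  source complex matter. The restriction of \<open>\<phi>\<close> to a subcomplex \<open>L\<close> is therefore
  \<open>\<phi>\<close> itself with source \<open>L\<close>.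
\<close>

definition simplicial_map :: "'a set set \<Rightarrow> 'b set set \<Rightarrow> ('a \<Rightarrow> 'b) \<Rightarrow> bool" where
  "simplicial_map A B f \<longleftrightarrow> (\<forall>\<sigma>\<in>A. f ` \<sigma> \<in> B)"

definition contiguous :: "'a set set \<Rightarrow> 'b set set \<Rightarrow> ('a \<Rightarrow> 'b) \<Rightarrow> ('a \<Rightarrow> 'b) \<Rightarrow> bool" where
  "contiguous A B f g \<longleftrightarrow> (\<forall>\<sigma>\<in>A. f ` \<sigma> \<union> g ` \<sigma> \<in> B)"

text \<open>
  Simplicial maps that agree on the vertices of the source are contiguous, so the
  values outside the source do not affect the following relation.
\<close>

definition same_contiguity_class ::
    "'a set set \<Rightarrow> 'b set set \<Rightarrow> ('a \<Rightarrow> 'b) \<Rightarrow> ('a \<Rightarrow> 'b) \<Rightarrow> bool" where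
  "same_contiguity_class A B f g \<longleftrightarrow>
     (\<exists>(n::nat) F. F 0 = f \<and> F n = g \<and>
        (\<forall>i\<le>n. simplicial_map A B (F i)) \<and>
        (\<forall>i<n. contiguous A B (F i) (F (Suc i))))"

definition covered_by :: "'a set set \<Rightarrow> nat \<Rightarrow> (nat \<Rightarrow> 'a set set) \<Rightarrow> bool" where
  "covered_by K k L \<longleftrightarrow> (\<forall>j\<le>k. subcomplex (L j) K) \<and> (\<Union>j\<le>k. L j) = K"

text \<open>The infimum of the empty set in \<^typ>\<open>enat\<close> is \<open>\<infinity>\<close>.\<close>

definition contiguity_distance ::
    "'a set set \<Rightarrow> 'b set set \<Rightarrow> ('a \<Rightarrow> 'b) \<Rightarrow> ('a \<Rightarrow> 'b) \<Rightarrow> enat" where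
  "contiguity_distance K K' \<phi> \<psi> =
     Inf {enat k | k. \<exists>L. covered_by K k L \<and> (\<forall>j\<le>k. same_contiguity_class (L j) K' \<phi> \<psi>)}"

text \<open>
  HOL cannot quantify over all vertex types of \<open>P\<close> inside a definition, so \<open>P\<close> ranges
  over the complexes with vertices in \<^typ>\<open>'a + nat\<close>, where \<^typ>\<open>'a\<close> is the vertex type
  of the target of \<open>\<eta>\<close>. This is no restriction: lemma \<open>m_contiguousD\<close> below derives the
  same property for \<open>P\<close> over an arbitrary vertex type.
\<close>

definition m_contiguous ::
    "nat \<Rightarrow> 'a set set \<Rightarrow> 'b set set \<Rightarrow> ('a \<Rightarrow> 'b) \<Rightarrow> ('a \<Rightarrow> 'b) \<Rightarrow> bool" where
  "m_contiguous m L K' \<phi> \<psi> \<longleftrightarrow>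
     (\<forall>(P :: ('a + nat) set set) \<eta>.
        abstract_complex P \<and> has_dimension P m \<and> simplicial_map P L \<eta> \<longrightarrow>
        same_contiguity_class P K' (\<phi> \<circ> \<eta>) (\<psi> \<circ> \<eta>))"

definition m_contiguity_distance ::
    "nat \<Rightarrow> 'a set set \<Rightarrow> 'b set set \<Rightarrow> ('a \<Rightarrow> 'b) \<Rightarrow> ('a \<Rightarrow> 'b) \<Rightarrow> enat" where
  "m_contiguity_distance m K K' \<phi> \<psi> =
     Inf {enat k | k. \<exists>L. covered_by K k L \<and> (\<forall>j\<le>k. m_contiguous m (L j) K' \<phi> \<psi>)}"

lemma same_contiguity_class_comp:
  assumes "same_contiguity_class A B f g" and "simplicial_map P A h"
  shows "same_contiguity_class P B (f \<circ> h) (g \<circ> h)"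
proof -
  obtain n F where F: "F 0 = f" "F n = g" "\<forall>i\<le>n. simplicial_map A B (F i)"
      "\<forall>i<n. contiguous A B (F i) (F (Suc i))"
    using assms(1) unfolding same_contiguity_class_def by blast
  have "\<forall>i\<le>n. simplicial_map P B (F i \<circ> h)"
    using F(3) assms(2) unfolding simplicial_map_def by (simp only: image_comp[symmetric]) blast
  moreover have "\<forall>i<n. contiguous P B (F i \<circ> h) (F (Suc i) \<circ> h)"
    using F(4) assms(2) unfolding simplicial_map_def contiguous_def
    by (simp only: image_comp[symmetric]) blast
  ultimately show ?thesis
    unfolding same_contiguity_class_def using F(1,2)
    by (intro exI[of _ n] exI[of _ "\<lambda>i. F i \<circ> h"]) auto
qed

lemma abstract_complexD:
  assumes "abstract_complex K" and "\<sigma> \<in> K"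
  shows "finite \<sigma>" and "\<sigma> \<noteq> {}" and "\<lbrakk>\<tau> \<noteq> {}; \<tau> \<subseteq> \<sigma>\<rbrakk> \<Longrightarrow> \<tau> \<in> K"
  using assms unfolding abstract_complex_def by blast+

lemma m_contiguousD:
  fixes L :: "'a set set" and P :: "'p set set"
  assumes L: "abstract_complex L" and m: "m_contiguous m L K' \<phi> \<psi>"
    and P: "abstract_complex P" "has_dimension P m" and \<eta>: "simplicial_map P L \<eta>"
  shows "same_contiguity_class P K' (\<phi> \<circ> \<eta>) (\<psi> \<circ> \<eta>)"
proof -
  obtain \<sigma> where "\<sigma> \<in> P" "card \<sigma> = Suc m"
    using P(2) by (auto simp: has_dimension_def)
  then obtain x where x: "x \<in> \<sigma>" by fastforce
  have "\<eta> ` \<sigma> \<in> L"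
    using \<eta> \<open>\<sigma> \<in> P\<close> by (simp add: simplicial_map_def)
  define v where "v = \<eta> x"
  have v: "{v} \<in> L"
    by (rule abstract_complexD(3)[OF L \<open>\<eta> ` \<sigma> \<in> L\<close>]) (use x v_def in auto)
  define Q :: "('a + nat) set set" where
    "Q = {Inl ` \<tau> | \<tau>. \<tau> \<in> L \<and> card \<tau> \<le> Suc m} \<union> {Inr ` \<tau> | \<tau>. \<tau> \<noteq> {} \<and> \<tau> \<subseteq> {..m}}"
  define h :: "'a + nat \<Rightarrow> 'a" where "h = case_sum id (\<lambda>_. v)"
  have "abstract_complex Q"
    unfolding abstract_complex_def
  proof (intro conjI ballI allI impI)
    fix \<rho> assume "\<rho> \<in> Q"
    moreover have "finite \<tau>" if "\<tau> \<subseteq> {..m}" for \<tau>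
      using that finite_atMost by (rule finite_subset)
    ultimately show "finite \<rho>" "\<rho> \<noteq> {}"
      using abstract_complexD(1,2)[OF L] unfolding Q_def by (blast intro: finite_imageI)+
  next
    fix \<rho> \<tau> assume "\<rho> \<in> Q" and \<tau>: "\<tau> \<noteq> {} \<and> \<tau> \<subseteq> \<rho>"
    then consider (l) \<rho>' where "\<rho> = Inl ` \<rho>'" "\<rho>' \<in> L" "card \<rho>' \<le> Suc m"
      | (r) \<rho>' where "\<rho> = Inr ` \<rho>'" "\<rho>' \<subseteq> {..m}"
      unfolding Q_def by blast
    then show "\<tau> \<in> Q"
    proof cases
      case l
      then obtain \<tau>' where \<tau>': "\<tau>' \<subseteq> \<rho>'" "\<tau> = Inl ` \<tau>'"
        using \<tau> by (auto elim: subset_imageE)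
      moreover have "\<tau>' \<in> L"
        using abstract_complexD(3)[OF L l(2), of \<tau>'] \<tau> \<tau>' by blast
      moreover have "card \<tau>' \<le> Suc m"
      proof -
        have "finite \<rho>'" by (rule abstract_complexD(1)[OF L l(2)])
        then have "card \<tau>' \<le> card \<rho>'" using \<tau>' by (simp add: card_mono)
        then show ?thesis using l by simp
      qed
      ultimately show ?thesis unfolding Q_def by blast
    next
      case r
      then obtain \<tau>' where "\<tau>' \<subseteq> \<rho>'" "\<tau> = Inr ` \<tau>'"
        using \<tau> by (auto elim: subset_imageE)
      then show ?thesis using r \<tau> unfolding Q_def by blast
    qed
  qed
  moreover have "has_dimension Q m"
    unfolding has_dimension_def
  proof
    have "Inr ` {..m} \<in> Q" unfolding Q_def by blast
    moreover have "card (Inr ` {..m} :: ('a + nat) set) = Suc m" by (simp add: card_image)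
    ultimately show "\<exists>\<sigma>\<in>Q. card \<sigma> = Suc m" by blast
  next
    have "card \<tau> \<le> Suc m" if "\<tau> \<subseteq> {..m}" for \<tau>
      using card_mono[OF _ that] by simp
    then show "\<forall>\<sigma>\<in>Q. card \<sigma> \<le> Suc m"
      by (auto simp: Q_def card_image)
  qed
  moreover have "simplicial_map Q L h"
    unfolding simplicial_map_def
  proof
    fix \<rho> assume "\<rho> \<in> Q"
    then consider (l) \<tau> where "\<rho> = Inl ` \<tau>" "\<tau> \<in> L"
      | (r) \<tau> where "\<rho> = Inr ` \<tau>" "\<tau> \<noteq> {}"
      unfolding Q_def by blast
    then show "h ` \<rho> \<in> L"
    proof cases
      case l
      then show ?thesis by (simp add: h_def image_image)
    next
      case r
      then have "h ` \<rho> = {v}" by (auto simp: h_def image_image)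
      then show ?thesis using v by (simp only:)
    qed
  qed
  ultimately have "same_contiguity_class Q K' (\<phi> \<circ> h) (\<psi> \<circ> h)"
    using m unfolding m_contiguous_def by blast
  moreover have "simplicial_map P Q (Inl \<circ> \<eta>)"
    unfolding simplicial_map_def
  proof
    fix \<rho> assume \<rho>: "\<rho> \<in> P"
    then have "finite \<rho>" "card \<rho> \<le> Suc m"
      using abstract_complexD(1)[OF P(1)] P(2) unfolding has_dimension_def by blast+
    then have "card (\<eta> ` \<rho>) \<le> Suc m"
      using card_image_le le_trans by blast
    then show "(Inl \<circ> \<eta>) ` \<rho> \<in> Q"
      using \<eta> \<rho> unfolding simplicial_map_def Q_def image_comp[symmetric] by blast
  qed
  ultimately have "same_contiguity_class P K' ((\<phi> \<circ> h) \<circ> (Inl \<circ> \<eta>)) ((\<psi> \<circ> h) \<circ> (Inl \<circ> \<eta>))"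
    by (rule same_contiguity_class_comp)
  moreover have "h \<circ> (Inl \<circ> \<eta>) = \<eta>"
    by (simp add: h_def fun_eq_iff)
  ultimately show ?thesis
    by (simp only: comp_assoc)
qed

end

(* The m-contiguity property always follows from the full one by precomposition. Conversely, if L has
   dimension at most m, one tests against a single P: the m-skeleton of the complex obtained from L
   by replacing each vertex by infinitely many copies. The copies of one vertex make P exactly
   m-dimensional even when L has smaller dimension, and L embeds in P as a section of the projection
   P -> L. *)

theory Submission
  imports Defs
begin

lemma same_contiguity_class_imp_m_contiguous:
  "same_contiguity_class L K' \<phi> \<psi> \<Longrightarrow> m_contiguous m L K' \<phi> \<psi>"
  unfolding m_contiguous_def by (blast intro: same_contiguity_class_comp)

text \<open>A cover may contain the empty subcomplex, which has no vertex to copy and so needs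
  separate treatment. All conditions hold vacuously.\<close>

lemma same_contiguity_class_empty: "same_contiguity_class {} K' \<phi> \<psi>"
  unfolding same_contiguity_class_def simplicial_map_def contiguous_def
  by (rule exI[of _ 1], rule exI[of _ "\<lambda>i. if i = 0 then \<phi> else \<psi>"]) simp

text \<open>The dimension of \<open>L\<close> is only bounded by \<open>m\<close>, since the members
  of a cover may have smaller dimension than \<open>K\<close>.\<close>

lemma m_contiguous_imp_same_contiguity_class:
  fixes L :: "'a set set"
  assumes L: "abstract_complex L" and dim: "\<And>\<sigma>. \<sigma> \<in> L \<Longrightarrow> card \<sigma> \<le> Suc m"
    and m: "m_contiguous m L K' \<phi> \<psi>"
  shows "same_contiguity_class L K' \<phi> \<psi>"
proof (cases "L = {}")
  case True
  then show ?thesis by (simp add: same_contiguity_class_empty)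
next
  case False
  then obtain \<sigma> where "\<sigma> \<in> L" by blast
  then obtain v where "v \<in> \<sigma>"
    using abstract_complexD(2)[OF L] by blast
  then have v: "{v} \<in> L"
    using abstract_complexD(3)[OF L \<open>\<sigma> \<in> L\<close>, of "{v}"] by simp
  \<comment> \<open>\<open>(a, i)\<close> is the \<open>i\<close>-th copy of \<open>a\<close>. A
    simplex may contain several copies of one vertex.\<close>
  define P :: "('a \<times> nat) set set" where
    "P = {\<rho>. finite \<rho> \<and> card \<rho> \<le> Suc m \<and> fst ` \<rho> \<in> L}"
  have "abstract_complex P"
    unfolding abstract_complex_def
  proof (intro conjI ballI allI impI)
    fix \<rho> assume "\<rho> \<in> P"
    then show "finite \<rho>" "\<rho> \<noteq> {}"
      using abstract_complexD(2)[OF L] unfolding P_def by blast+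
  next
    fix \<rho> \<tau> assume \<rho>: "\<rho> \<in> P" and \<tau>: "\<tau> \<noteq> {} \<and> \<tau> \<subseteq> \<rho>"
    then have "finite \<tau>" and "card \<tau> \<le> card \<rho>"
      unfolding P_def by (auto intro: finite_subset card_mono)
    moreover have "fst ` \<tau> \<in> L"
      using \<rho> \<tau> abstract_complexD(3)[OF L, of "fst ` \<rho>" "fst ` \<tau>"]
      unfolding P_def by blast
    ultimately show "\<tau> \<in> P"
      using \<rho> unfolding P_def by simp
  qed
  moreover have "has_dimension P m"
  proof -
    \<comment> \<open>These \<open>Suc m\<close> copies of \<open>v\<close> project to
      \<open>{v}\<close>, so dimension \<open>m\<close> is attained whatever the dimension of
      \<open>L\<close>.\<close>
    have "{v} \<times> {..m} \<in> P"
      using v unfolding P_def by (simp add: card_cartesian_product)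
    moreover have "card ({v} \<times> {..m}) = Suc m"
      by (simp add: card_cartesian_product)
    ultimately show ?thesis
      unfolding has_dimension_def P_def by blast
  qed
  moreover have "simplicial_map P L fst"
    unfolding simplicial_map_def P_def by blast
  \<comment> \<open>The vertices of \<open>P\<close> lie in \<open>'a \<times> nat\<close> instead
    of \<open>'a + nat\<close>, hence \<open>m_contiguousD\<close>.\<close>
  ultimately have "same_contiguity_class P K' (\<phi> \<circ> fst) (\<psi> \<circ> fst)"
    by (rule m_contiguousD[OF L m])
  \<comment> \<open>This section of \<open>fst\<close> lands in the skeleton because of
    \<open>dim\<close>.\<close>
  moreover have "simplicial_map L P (\<lambda>a. (a, 0))"
    unfolding simplicial_map_def
  proof
    fix \<sigma> assume \<sigma>: "\<sigma> \<in> L"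
    then have "card ((\<lambda>a. (a, 0::nat)) ` \<sigma>) \<le> Suc m"
      using dim card_image_le[OF abstract_complexD(1)[OF L \<sigma>]] le_trans by blast
    then show "(\<lambda>a. (a, 0)) ` \<sigma> \<in> P"
      using \<sigma> abstract_complexD(1)[OF L \<sigma>] unfolding P_def by (simp add: image_image)
  qed
  ultimately have "same_contiguity_class L K'
      ((\<phi> \<circ> fst) \<circ> (\<lambda>a. (a, 0::nat))) ((\<psi> \<circ> fst) \<circ> (\<lambda>a. (a, 0::nat)))"
    by (rule same_contiguity_class_comp)
  then show ?thesis by (simp add: comp_def)
qed

theorem theorem3p2:
  fixes K :: "'a set set" and K' :: "'b set set" and \<phi> \<psi> :: "'a \<Rightarrow> 'b" and d :: nat
  assumes "abstract_complex K" and "abstract_complex K'"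
    and "edge_path_connected K" and "edge_path_connected K'"
    and "has_dimension K d"
    and "simplicial_map K K' \<phi>" and "simplicial_map K K' \<psi>"
  shows "m_contiguity_distance d K K' \<phi> \<psi> = contiguity_distance K K' \<phi> \<psi>"
proof -
  have "m_contiguous d L K' \<phi> \<psi> \<longleftrightarrow> same_contiguity_class L K' \<phi> \<psi>"
    if "subcomplex L K" for L
  proof
    have "abstract_complex L" and "\<And>\<sigma>. \<sigma> \<in> L \<Longrightarrow> card \<sigma> \<le> Suc d"
      using that assms(5) unfolding subcomplex_def has_dimension_def by blast+
    then show "same_contiguity_class L K' \<phi> \<psi>" if "m_contiguous d L K' \<phi> \<psi>"
      using that by (rule m_contiguous_imp_same_contiguity_class)
  qed (rule same_contiguity_class_imp_m_contiguous)
  \<comment> \<open>Both distances thus admit the same covers, so the infima agree, also when they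
    are \<infinity>.\<close>
  then have "(covered_by K k L \<and> (\<forall>j\<le>k. m_contiguous d (L j) K' \<phi> \<psi>)) \<longleftrightarrow>
      (covered_by K k L \<and> (\<forall>j\<le>k. same_contiguity_class (L j) K' \<phi> \<psi>))" for k L
    by (auto simp: covered_by_def)
  then show ?thesis
    unfolding m_contiguity_distance_def contiguity_distance_def by simp
qed

end
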